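(* Let $\mathbb{T}$ be the homogeneous tree of degree $q+1>2$ and let $U:\mathbb{T}\times\mathbb{T}\to\mathbb{C}$ be a function such that $$\mathcal{L}^{\mathbb{T}}_x\,U(x,y)=\mathcal{L}^{\mathbb{T}}_y\,U(x,y)\qquad\text{for all }x,y\in\mathbb{T}.$$ Then $$\sum_{x'\in S(x,m)}\;\sum_{y'\in S(y,n)}U(x',y')=\sum_{x'\in S(x,n)}\;\sum_{y'\in S(y,m)}U(x',y')$$ for every $x,y\in\mathbb{T}$ and $m,n\in\mathbb{N}=\{0,1,2,\dots\}$. In particular $$\sum_{x'\in S(x,n)}U(x',y)=\sum_{y'\in S(y,n)}U(x,y').$$
   Context: $\mathbb{T}=\mathbb{T}_q$ ($q\ge2$ an integer) is the homogeneous tree of degree $q+1$: the connected graph without loops in which every vertex has exactly $q+1$ neighbors. It is identified with its vertex set; $d$ is the graph distance and $S(x,n)=\{y\in\mathbb{T}:d(x,y)=n\}$. The combinatorial Laplacian is $\mathcal{L}^{\mathbb{T}}f(x)=f(x)-\frac1{q+1}\sum_{y\in S(x,1)}f(y)$; a subscript $x$ or $y$ indicates the variable in which it acts. *)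

theory Defs
  imports
    Complex_Main
    "Graph_Theory.Digraph_Component"
    "Graph_Theory.Shortest_Path"
begin

text \<open>
  Undirected simple graphs are symmetric, loop-free sets of ordered pairs
  (\<^locale>\<open>pair_bidirected_digraph\<close>). The library predicate \<^const>\<open>tree\<close>
  cannot be used for them: in a symmetric digraph the closed walk \<open>a, b, a\<close> counts as
  a \<^const>\<open>pre_digraph.cycle\<close>. Cycles of an undirected simple graph are exactly the
  directed cycles with at least three arcs.
\<close>

locale homogeneous_tree = pair_bidirected_digraph T
  for q :: nat and T :: "'a pair_pre_digraph" +
  assumes connected: "connected (with_proj T)"
    and acyclic: "\<not> (\<exists>p. pre_digraph.cycle (with_proj T) p \<and> length p \<ge> 3)"
    and degree: "v \<in> pverts T \<Longrightarrow> card {w. (v, w) \<in> parcs T} = q + 1"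

text \<open>The graph distance is the cost of a shortest path when every edge has weight one.\<close>

definition graph_dist :: "'a pair_pre_digraph \<Rightarrow> 'a \<Rightarrow> 'a \<Rightarrow> ereal" where
  "graph_dist T x y = wf_digraph.\<mu> (with_proj T) (\<lambda>_. 1) x y"

definition sphere :: "'a pair_pre_digraph \<Rightarrow> 'a \<Rightarrow> nat \<Rightarrow> 'a set" where
  "sphere T x n = {y \<in> pverts T. graph_dist T x y = ereal (real n)}"

definition laplacian ::
    "nat \<Rightarrow> 'a pair_pre_digraph \<Rightarrow> ('a \<Rightarrow> complex) \<Rightarrow> 'a \<Rightarrow> complex" where
  "laplacian q T f x = f x - 1 / of_nat (q + 1) * (\<Sum>y\<in>sphere T x 1. f y)"

end

theory Submission
  imports Defs
begin

text \<open>
  Write \<open>A\<^sub>n f x\<close> for the sum of \<open>f\<close> over \<open>S(x, n)\<close>. In a homogeneous tree of degree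
  \<open>q + 1\<close> a vertex at distance \<open>n + 1\<close> from \<open>x\<close> has exactly one neighbour at distance \<open>n\<close>
  and all its other neighbours at distance \<open>n + 2\<close>. Counting pairs of neighbours gives
  \<open>A\<^sub>n\<^sub>+\<^sub>2 = A\<^sub>n\<^sub>+\<^sub>1 A\<^sub>1 - c\<^sub>n A\<^sub>n\<close>, where \<open>c\<^sub>0 = q + 1\<close> and \<open>c\<^sub>n = q\<close> for
  \<open>n > 0\<close> (lemma \<open>sphere_sum_rec\<close>). So every \<open>A\<^sub>n\<close> is a polynomial in \<open>A\<^sub>1\<close>, and the
  \<open>A\<^sub>n\<close> commute with each other (lemma \<open>sphere_sum_commute\<close>).

  The hypothesis on the Laplacians says that \<open>A\<^sub>1\<close> acts on \<open>U\<close> in the same way in either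
  variable. Operators in different variables commute, so the recurrence carries this over to
  every \<open>A\<^sub>n\<close> (lemma \<open>sphere_sum_transfer\<close>), which is the second claim. For the first, move
  \<open>A\<^sub>n\<close> from the second variable to the first, exchange it there with \<open>A\<^sub>m\<close>, and move
  \<open>A\<^sub>m\<close> to the second variable.

  The geometric input is the uniqueness of the neighbour nearer to \<open>x\<close> (lemma
  \<open>parent_unique\<close>) and the absence of edges within a sphere (lemma \<open>ndist_arc_neq\<close>). Two
  distinct vertices of \<open>S(x, n)\<close> are joined by a path of length at least two inside the ball of
  radius \<open>n\<close> (lemma \<open>apath_within_ball\<close>), and a violation of either property would close
  such a path to a cycle.
\<close>

section \<open>Distances in a homogeneous tree\<close>

context homogeneous_tree
begin

text \<open>
  The graph distance as a natural number: the least length of a walk. The value is meaningful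
  only when a walk exists, which holds for all pairs of vertices by connectedness.
\<close>

definition ndist :: "'a \<Rightarrow> 'a \<Rightarrow> nat" where
  "ndist x y = (LEAST n. \<exists>p. awalk x p y \<and> length p = n)"

lemma ex_awalk:
  assumes "x \<in> pverts T" "y \<in> pverts T"
  shows "\<exists>p. awalk x p y"
proof -
  have "strongly_connected (with_proj T)"
    using connected sym_arcs symmetric_connected_imp_strongly_connected by blast
  then have "x \<rightarrow>\<^sup>*\<^bsub>with_proj T\<^esub> y"
    using assms by auto
  then show ?thesis
    by (simp add: reachable_awalk)
qed

lemma ndist_awalk:
  assumes "x \<in> pverts T" "y \<in> pverts T"
  obtains p where "awalk x p y" "length p = ndist x y"
  using LeastI_ex[of "\<lambda>n. \<exists>p. awalk x p y \<and> length p = n"] ex_awalk[OF assms]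
  unfolding ndist_def by blast

lemma ndist_le: "awalk x p y \<Longrightarrow> ndist x y \<le> length p"
  unfolding ndist_def by (rule Least_le) blast

lemma awalk_cost_one: "awalk_cost (\<lambda>_. 1) p = real (length p)"
  by (induction p) auto

lemma graph_dist_eq_ndist:
  assumes "x \<in> pverts T" "y \<in> pverts T"
  shows "graph_dist T x y = ereal (real (ndist x y))"
  unfolding graph_dist_def
proof (rule antisym)
  obtain p where p: "awalk x p y" "length p = ndist x y"
    using ndist_awalk[OF assms] .
  show "\<mu> (\<lambda>_. 1) x y \<le> ereal (real (ndist x y))"
    using min_cost_le_walk_cost[OF p(1), of "\<lambda>_. 1"] p(2) by (simp add: awalk_cost_one)
  show "ereal (real (ndist x y)) \<le> \<mu> (\<lambda>_. 1) x y"
    unfolding \<mu>_def by (rule INF_greatest) (auto simp: awalk_cost_one dest: ndist_le)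
qed

lemma sphere_eq: "x \<in> pverts T \<Longrightarrow> sphere T x n = {y \<in> pverts T. ndist x y = n}"
  by (auto simp: sphere_def graph_dist_eq_ndist)

lemma ndist_eq_0_iff:
  assumes "x \<in> pverts T" "y \<in> pverts T"
  shows "ndist x y = 0 \<longleftrightarrow> x = y"
proof
  assume "ndist x y = 0"
  then show "x = y" using ndist_awalk[OF assms] by (metis awalk_Nil_iff length_0_conv)
next
  assume "x = y"
  then show "ndist x y = 0" using ndist_le[of x "[]" x] assms by (simp add: awalk_Nil_iff)
qed

lemma arc_in_verts: "(y, z) \<in> parcs T \<Longrightarrow> y \<in> pverts T \<and> z \<in> pverts T"
  using arc_fst_in_verts arc_snd_in_verts by fastforce

lemma arc_sym: "(y, z) \<in> parcs T \<Longrightarrow> (z, y) \<in> parcs T"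
  by (rule arcs_symmetric)

lemma ndist_arc_le:
  assumes "x \<in> pverts T" "(y, z) \<in> parcs T"
  shows "ndist x z \<le> Suc (ndist x y)"
proof -
  obtain p where p: "awalk x p y" "length p = ndist x y"
    using ndist_awalk assms arc_in_verts by metis
  then have "awalk x (p @ [(y, z)]) z"
    using assms arc_in_verts by (auto simp: awalk_simps)
  from ndist_le[OF this] p(2) show ?thesis by simp
qed

lemma ndist_SucE:
  assumes "x \<in> pverts T" "z \<in> pverts T" "ndist x z = Suc n"
  obtains y where "(y, z) \<in> parcs T" "ndist x y = n"
proof -
  obtain p where p: "awalk x p z" "length p = Suc n"
    using ndist_awalk assms by metis
  obtain r e where r: "p = r @ [e]" using p(2) by (cases p rule: rev_cases) auto
  with p(1) have "awalk x r (fst e)" and e: "e \<in> parcs T" "snd e = z"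
    by (auto simp: awalk_simps)
  then have "ndist x (fst e) \<le> n" using ndist_le p(2) r by fastforce
  moreover have "(fst e, z) \<in> parcs T" using e by auto
  moreover from this have "Suc n \<le> Suc (ndist x (fst e))"
    using ndist_arc_le[OF assms(1), of "fst e" z] assms(3) by simp
  ultimately show thesis using that by auto
qed

text \<open>
  Acyclicity in the form in which it is used: an edge joining the ends of a path of length at
  least two would close a cycle with at least three arcs.
\<close>

lemma no_arc_closing_apath:
  assumes "apath v p w" "length p \<ge> 2"
  shows "(w, v) \<notin> parcs T"
proof
  assume "(w, v) \<in> parcs T"
  then have "cycle ((w, v) # p)"
    using assms(1) unfolding cycle_def
    by (intro exI[of _ w]) (auto simp: apath_def awalk_Cons_iff)
  then show False using acyclic assms(2) by fastforce
qed

lemma apath_extend: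
  assumes "apath v' p w'" "(v, v') \<in> parcs T" "(w', w) \<in> parcs T"
    and "v \<notin> set (awalk_verts v' p)" "w \<notin> set (awalk_verts v' p)" "v \<noteq> w"
  shows "apath v ((v, v') # p @ [(w', w)]) w"
    and "set (awalk_verts v ((v, v') # p @ [(w', w)])) = {v, w} \<union> set (awalk_verts v' p)"
proof -
  have p: "awalk v' p w'" using assms(1) by (simp add: apath_def)
  have q: "awalk v' (p @ [(w', w)]) w"
    using p assms(3) arc_in_verts by (auto simp: awalk_simps)
  have verts: "awalk_verts v' (p @ [(w', w)]) = awalk_verts v' p @ [w]"
    using q by (subst awalk_verts_append) auto
  show "apath v ((v, v') # p @ [(w', w)]) w"
    using q assms verts by (auto simp: apath_def awalk_Cons_iff)
  show "set (awalk_verts v ((v, v') # p @ [(w', w)])) = {v, w} \<union> set (awalk_verts v' p)"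
    using verts by auto
qed

text \<open>
  The path climbs from \<open>v\<close> and \<open>w\<close> towards \<open>x\<close> in parallel until the two branches
  meet. The vertices added last lie in \<open>S(x, n)\<close>, the rest at smaller distance, so the path does
  not repeat a vertex.
\<close>

lemma apath_within_ball:
  assumes "x \<in> pverts T" "v \<in> pverts T" "w \<in> pverts T" "v \<noteq> w"
    and "ndist x v = n" "ndist x w = n"
  obtains p where "apath v p w" "length p \<ge> 2" "\<forall>z\<in>set (awalk_verts v p). ndist x z \<le> n"
proof -
  have "\<exists>p. apath v p w \<and> length p \<ge> 2 \<and> (\<forall>z\<in>set (awalk_verts v p). ndist x z \<le> n)"
    using assms(2-)
  proof (induction n arbitrary: v w)
    case 0
    then show ?case using ndist_eq_0_iff assms(1) by metis
  next
    case (Suc n)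
    obtain v' where v': "(v', v) \<in> parcs T" "ndist x v' = n"
      using ndist_SucE assms(1) Suc.prems by metis
    obtain w' where w': "(w', w) \<in> parcs T" "ndist x w' = n"
      using ndist_SucE assms(1) Suc.prems by metis
    have "\<exists>p. apath v' p w' \<and> (\<forall>z\<in>set (awalk_verts v' p). ndist x z \<le> n)"
    proof (cases "v' = w'")
      case True
      then show ?thesis
        using v' arc_in_verts by (intro exI[of _ "[]"]) (auto simp: apath_Nil_iff)
    next
      case False
      then show ?thesis using Suc.IH[of v' w'] v' w' arc_in_verts by blast
    qed
    then obtain p where p: "apath v' p w'" "\<forall>z\<in>set (awalk_verts v' p). ndist x z \<le> n"
      by blast
    have "v \<notin> set (awalk_verts v' p)" "w \<notin> set (awalk_verts v' p)"
      using p(2) Suc.prems by (metis Suc_n_not_le_n)+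
    note ext = apath_extend[OF p(1) arc_sym[OF v'(1)] w'(1) this Suc.prems(3)]
    show ?case
      using Suc.prems p(2) ext
      by (intro exI[of _ "(v, v') # p @ [(w', w)]"]) (auto simp del: awalk_verts_with_proj_eq
          intro: le_SucI)
  qed
  with that show thesis by blast
qed

lemma ndist_arc_neq:
  assumes "x \<in> pverts T" "(v, w) \<in> parcs T"
  shows "ndist x v \<noteq> ndist x w"
proof
  assume eq: "ndist x v = ndist x w"
  have "v \<noteq> w" using assms(2) pair_no_loops by fastforce
  then obtain p where "apath v p w" "length p \<ge> 2"
    using apath_within_ball assms arc_in_verts eq by metis
  then show False using no_arc_closing_apath arc_sym assms(2) by blast
qed

lemma parent_unique:
  assumes "x \<in> pverts T" "(v, z) \<in> parcs T" "(w, z) \<in> parcs T"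
    and "ndist x v = n" "ndist x w = n" "ndist x z = Suc n"
  shows "v = w"
proof (rule ccontr)
  assume "v \<noteq> w"
  then obtain p where p: "apath v p w" "length p \<ge> 2" 
      "\<forall>u\<in>set (awalk_verts v p). ndist x u \<le> n"
    using apath_within_ball assms arc_in_verts by metis
  have "z \<notin> set (awalk_verts v p)" using p(3) assms(6) by (metis Suc_n_not_le_n)
  then have "apath z ((z, v) # p) w"
    using p(1) arc_sym[OF assms(2)] arc_in_verts by (auto simp: apath_Cons_iff)
  from no_arc_closing_apath[OF this] p(2) assms(3) show False by simp
qed

section \<open>Neighbours and spheres\<close>

text \<open>The neighbours of a vertex.\<close>

definition nbrs :: "'a \<Rightarrow> 'a set" where
  "nbrs v = {w. (v, w) \<in> parcs T}"

lemma card_nbrs: "v \<in> pverts T \<Longrightarrow> card (nbrs v) = q + 1"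
  unfolding nbrs_def by (rule degree)

text \<open>Finiteness follows from the degree because infinite sets have cardinality zero.\<close>

lemma finite_nbrs: "v \<in> pverts T \<Longrightarrow> finite (nbrs v)"
  using card_nbrs by (metis Suc_eq_plus1 card.infinite nat.distinct(1))

lemma nbrs_sym: "w \<in> nbrs v \<longleftrightarrow> v \<in> nbrs w"
  using arc_sym by (auto simp: nbrs_def)

lemma sphere_subset: "sphere T x n \<subseteq> pverts T"
  by (auto simp: sphere_def)

lemma sphere_0: "x \<in> pverts T \<Longrightarrow> sphere T x 0 = {x}"
  by (auto simp: sphere_eq ndist_eq_0_iff)

lemma sphere_1:
  assumes "x \<in> pverts T"
  shows "sphere T x 1 = nbrs x"
proof (intro equalityI subsetI)
  fix y assume "y \<in> sphere T x 1"
  then have y: "y \<in> pverts T" "ndist x y = Suc 0" using assms by (auto simp: sphere_eq)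
  obtain z where "(z, y) \<in> parcs T" "ndist x z = 0"
    using ndist_SucE[OF assms y] .
  then show "y \<in> nbrs x" using assms arc_in_verts by (auto simp: ndist_eq_0_iff nbrs_def)
next
  fix y assume "y \<in> nbrs x"
  then have a: "(x, y) \<in> parcs T" by (simp add: nbrs_def)
  have "ndist x x = 0" using assms by (simp add: ndist_eq_0_iff)
  then have "ndist x y = 1"
    using ndist_arc_le[OF assms a] ndist_arc_neq[OF assms a] by simp
  then show "y \<in> sphere T x 1" using assms a arc_in_verts by (simp add: sphere_eq)
qed

lemma finite_sphere:
  assumes "x \<in> pverts T"
  shows "finite (sphere T x n)"
proof (induction n)
  case 0
  then show ?case using assms by (simp add: sphere_0)
next
  case (Suc n)
  have "sphere T x (Suc n) \<subseteq> (\<Union>y\<in>sphere T x n. nbrs y)"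
  proof
    fix z assume "z \<in> sphere T x (Suc n)"
    then obtain y where "(y, z) \<in> parcs T" "ndist x y = n"
      using ndist_SucE[OF assms, of z n] assms by (auto simp: sphere_eq)
    then show "z \<in> (\<Union>y\<in>sphere T x n. nbrs y)"
      using assms arc_in_verts by (auto simp: sphere_eq nbrs_def)
  qed
  moreover have "finite (\<Union>y\<in>sphere T x n. nbrs y)"
    using Suc finite_nbrs sphere_subset by blast
  ultimately show ?case by (rule finite_subset)
qed

lemma nbrs_split:
  assumes "x \<in> pverts T" "z \<in> sphere T x (Suc n)"
  shows "nbrs z = (nbrs z \<inter> sphere T x (Suc (Suc n))) \<union> (nbrs z \<inter> sphere T x n)"
proof -
  have "w \<in> sphere T x (Suc (Suc n)) \<union> sphere T x n" if w: "w \<in> nbrs z" for w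
  proof -
    have a: "(z, w) \<in> parcs T" using w by (simp add: nbrs_def)
    have "ndist x z = Suc n" using assms by (simp add: sphere_eq)
    with ndist_arc_le[OF assms(1) a] ndist_arc_le[OF assms(1) arc_sym[OF a]]
      ndist_arc_neq[OF assms(1) a]
    have "ndist x w = Suc (Suc n) \<or> ndist x w = n" by linarith
    then show ?thesis using assms(1) arc_in_verts[OF a] by (auto simp: sphere_eq)
  qed
  then show ?thesis by blast
qed

lemma sphere_disjoint: "x \<in> pverts T \<Longrightarrow> m \<noteq> n \<Longrightarrow> sphere T x m \<inter> sphere T x n = {}"
  by (auto simp: sphere_eq)

lemma card_parents:
  assumes "x \<in> pverts T" "w \<in> sphere T x (Suc n)"
  shows "card (nbrs w \<inter> sphere T x n) = 1"
proof -
  have w: "w \<in> pverts T" "ndist x w = Suc n" using assms by (auto simp: sphere_eq)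
  obtain z where z: "(z, w) \<in> parcs T" "ndist x z = n"
    using ndist_SucE[OF assms(1) w] .
  have "v = z" if "v \<in> nbrs w \<inter> sphere T x n" for v
    using that parent_unique[OF assms(1) arc_sym z(1) _ z(2) w(2)] assms(1)
    by (simp add: sphere_eq nbrs_def)
  moreover have "z \<in> nbrs w \<inter> sphere T x n"
    using z assms(1) arc_sym[OF z(1)] arc_in_verts[OF z(1)] by (simp add: sphere_eq nbrs_def)
  ultimately have "nbrs w \<inter> sphere T x n = {z}" by blast
  then show ?thesis by simp
qed

lemma card_children:
  assumes "x \<in> pverts T" "w \<in> sphere T x n"
  shows "card (nbrs w \<inter> sphere T x (Suc n)) = (if n = 0 then q + 1 else q)"
proof (cases n)
  case 0
  then have "w = x" using assms by (simp add: sphere_0)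
  then show ?thesis using 0 assms(1) sphere_1 card_nbrs by simp
next
  case (Suc k)
  have w: "w \<in> pverts T" using assms(2) sphere_subset by blast
  have "(nbrs w \<inter> sphere T x (Suc n)) \<inter> (nbrs w \<inter> sphere T x k) = {}"
    using sphere_disjoint[OF assms(1), of "Suc n" k] Suc by auto
  then have "card (nbrs w) = card (nbrs w \<inter> sphere T x (Suc n)) + card (nbrs w \<inter> sphere T x k)"
    using nbrs_split[OF assms(1) assms(2)[unfolded Suc]] Suc finite_nbrs[OF w]
    by (metis card_Un_disjoint finite_Int)
  then show ?thesis
    using card_nbrs[OF w] card_parents[OF assms(1) assms(2)[unfolded Suc]] Suc by simp
qed

section \<open>Spherical sums\<close>

text \<open>
  The operator \<open>A\<^sub>n\<close> summing a function over the sphere of radius \<open>n\<close>. Its value at \<open>x\<close>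
  involves only the values of the function at vertices, so operator identities are stated at
  vertices and applied under further spherical sums by \<open>sphere_sum_cong\<close>.
\<close>

definition sphere_sum :: "nat \<Rightarrow> ('a \<Rightarrow> 'b::comm_ring_1) \<Rightarrow> 'a \<Rightarrow> 'b" where
  "sphere_sum n f x = (\<Sum>y\<in>sphere T x n. f y)"

lemma sphere_sum_cong:
  "(\<And>y. y \<in> pverts T \<Longrightarrow> f y = g y) \<Longrightarrow> sphere_sum n f x = sphere_sum n g x"
  unfolding sphere_sum_def using sphere_subset by (intro sum.cong) auto

lemma sphere_sum_0: "x \<in> pverts T \<Longrightarrow> sphere_sum 0 f x = f x"
  by (simp add: sphere_sum_def sphere_0)

lemma sphere_sum_diff_scale:
  "sphere_sum n (\<lambda>y. f y - c * g y) x = sphere_sum n f x - c * sphere_sum n g x"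
  by (simp add: sphere_sum_def sum_subtractf sum_distrib_left)

text \<open>Double counting of the edges between two spheres about the same centre.\<close>

lemma sum_sphere_nbrs:
  fixes f :: "'a \<Rightarrow> 'b::comm_ring_1"
  assumes "x \<in> pverts T" and card: "\<And>w. w \<in> sphere T x m \<Longrightarrow> card (nbrs w \<inter> sphere T x n) = k"
  shows "(\<Sum>z\<in>sphere T x n. \<Sum>w\<in>nbrs z \<inter> sphere T x m. f w) = of_nat k * (\<Sum>w\<in>sphere T x m. f w)"
proof -
  have "(\<Sum>z\<in>sphere T x n. \<Sum>w\<in>nbrs z \<inter> sphere T x m. f w)
      = (\<Sum>z\<in>sphere T x n. \<Sum>w\<in>{w \<in> sphere T x m. w \<in> nbrs z}. f w)"
    by (intro sum.cong) auto
  also have "\<dots> = (\<Sum>w\<in>sphere T x m. \<Sum>z\<in>{z \<in> sphere T x n. w \<in> nbrs z}. f w)"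
    using assms(1) finite_sphere by (intro sum.swap_restrict) auto
  also have "\<dots> = (\<Sum>w\<in>sphere T x m. of_nat k * f w)"
  proof (intro sum.cong refl)
    fix w assume "w \<in> sphere T x m"
    moreover have "{z \<in> sphere T x n. w \<in> nbrs z} = nbrs w \<inter> sphere T x n"
      using nbrs_sym by blast
    ultimately show "(\<Sum>z\<in>{z \<in> sphere T x n. w \<in> nbrs z}. f w) = of_nat k * f w"
      using card by simp
  qed
  finally show ?thesis by (simp add: sum_distrib_left)
qed

text \<open>
  In \<open>A\<^sub>n\<^sub>+\<^sub>1 A\<^sub>1 f x\<close> each vertex of \<open>S(x, n + 2)\<close> is counted once, through its parent,
  and each vertex of \<open>S(x, n)\<close> once for each of its children.
\<close>

lemma sphere_sum_rec:
  fixes f :: "'a \<Rightarrow> 'b::comm_ring_1"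
  assumes x: "x \<in> pverts T"
  shows "sphere_sum (Suc (Suc n)) f x
    = sphere_sum (Suc n) (sphere_sum 1 f) x
      - of_nat (if n = 0 then q + 1 else q) * sphere_sum n f x"
proof -
  have "sphere_sum (Suc n) (sphere_sum 1 f) x
      = (\<Sum>z\<in>sphere T x (Suc n). (\<Sum>w\<in>nbrs z \<inter> sphere T x (Suc (Suc n)). f w)
          + (\<Sum>w\<in>nbrs z \<inter> sphere T x n. f w))"
    unfolding sphere_sum_def
  proof (intro sum.cong refl)
    fix z assume z: "z \<in> sphere T x (Suc n)"
    then have zv: "z \<in> pverts T" using sphere_subset by blast
    have "(nbrs z \<inter> sphere T x (Suc (Suc n))) \<inter> (nbrs z \<inter> sphere T x n) = {}"
      using sphere_disjoint[OF x, of "Suc (Suc n)" n] by auto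
    then have "(\<Sum>w\<in>nbrs z. f w) = (\<Sum>w\<in>nbrs z \<inter> sphere T x (Suc (Suc n)). f w)
          + (\<Sum>w\<in>nbrs z \<inter> sphere T x n. f w)"
      using nbrs_split[OF x z] finite_nbrs[OF zv] by (metis finite_Int sum.union_disjoint)
    then show "sum f (sphere T z 1) = (\<Sum>w\<in>nbrs z \<inter> sphere T x (Suc (Suc n)). f w)
          + (\<Sum>w\<in>nbrs z \<inter> sphere T x n. f w)"
      using sphere_1[OF zv] by simp
  qed
  also have "\<dots> = of_nat 1 * sphere_sum (Suc (Suc n)) f x
      + of_nat (if n = 0 then q + 1 else q) * sphere_sum n f x"
    unfolding sum.distrib sphere_sum_def
    using sum_sphere_nbrs[OF x card_parents[OF x], where n = "Suc n" and f = f]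
      sum_sphere_nbrs[OF x card_children[OF x], where m = n and f = f] by simp
  finally show ?thesis by simp
qed

lemma sphere_sum_commute_1:
  fixes f :: "'a \<Rightarrow> 'b::comm_ring_1"
  assumes "x \<in> pverts T"
  shows "sphere_sum n (sphere_sum 1 f) x = sphere_sum 1 (sphere_sum n f) x"
  using assms
proof (induction n arbitrary: f x rule: induct_nat_012)
  case 0
  have "sphere_sum 1 (sphere_sum 0 f) x = sphere_sum 1 f x"
    by (rule sphere_sum_cong) (rule sphere_sum_0)
  with 0 show ?case by (simp add: sphere_sum_0)
next
  case 1
  then show ?case by simp
next
  case (ge2 n)
  let ?c = "of_nat (if n = 0 then q + 1 else q) :: 'b"
  have "sphere_sum (Suc (Suc n)) (sphere_sum 1 f) x
      = sphere_sum 1 (sphere_sum (Suc n) (sphere_sum 1 f)) x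
        - ?c * sphere_sum 1 (sphere_sum n f) x"
    using sphere_sum_rec[OF ge2.prems, of n "sphere_sum 1 f"]
      ge2.IH(1)[OF ge2.prems] ge2.IH(2)[OF ge2.prems] by simp
  also have "\<dots> = sphere_sum 1 (sphere_sum (Suc (Suc n)) f) x"
    unfolding sphere_sum_diff_scale[symmetric]
    by (rule sphere_sum_cong) (rule sphere_sum_rec[symmetric])
  finally show ?case .
qed

lemma sphere_sum_commute:
  fixes f :: "'a \<Rightarrow> 'b::comm_ring_1"
  assumes "x \<in> pverts T"
  shows "sphere_sum m (sphere_sum n f) x = sphere_sum n (sphere_sum m f) x"
  using assms
proof (induction m arbitrary: f x rule: induct_nat_012)
  case 0
  have "sphere_sum n (sphere_sum 0 f) x = sphere_sum n f x"
    by (rule sphere_sum_cong) (rule sphere_sum_0)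
  with 0 show ?case by (simp add: sphere_sum_0)
next
  case 1
  then show ?case using sphere_sum_commute_1[of x n f] by simp
next
  case (ge2 m)
  let ?c = "of_nat (if m = 0 then q + 1 else q) :: 'b"
  have "sphere_sum (Suc (Suc m)) (sphere_sum n f) x
      = sphere_sum (Suc m) (sphere_sum 1 (sphere_sum n f)) x - ?c * sphere_sum m (sphere_sum n f) x"
    by (rule sphere_sum_rec[OF ge2.prems])
  also have "sphere_sum (Suc m) (sphere_sum 1 (sphere_sum n f)) x
      = sphere_sum (Suc m) (sphere_sum n (sphere_sum 1 f)) x"
    by (rule sphere_sum_cong) (rule sphere_sum_commute_1[symmetric])
  also have "\<dots> = sphere_sum n (sphere_sum (Suc m) (sphere_sum 1 f)) x"
    by (rule ge2.IH(2)[OF ge2.prems])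
  also have "sphere_sum m (sphere_sum n f) x = sphere_sum n (sphere_sum m f) x"
    by (rule ge2.IH(1)[OF ge2.prems])
  also have "sphere_sum n (sphere_sum (Suc m) (sphere_sum 1 f)) x
        - ?c * sphere_sum n (sphere_sum m f) x
      = sphere_sum n (sphere_sum (Suc (Suc m)) f) x"
    unfolding sphere_sum_diff_scale[symmetric]
    by (rule sphere_sum_cong) (rule sphere_sum_rec[symmetric])
  finally show ?case .
qed

section \<open>Functions of two variables\<close>

lemma laplacian_eq_iff:
  "laplacian q T f x = laplacian q T g y \<longleftrightarrow>
    f x - sphere_sum 1 f x / of_nat (q + 1) = g y - sphere_sum 1 g y / of_nat (q + 1)"
  by (simp add: laplacian_def sphere_sum_def)

lemma sphere_sum_swap:
  "sphere_sum m (\<lambda>x'. sphere_sum n (\<lambda>y'. V x' y') y) x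
    = sphere_sum n (\<lambda>y'. sphere_sum m (\<lambda>x'. V x' y') x) y"
  unfolding sphere_sum_def by (rule sum.swap)

text \<open>
  In the inductive step one factor \<open>A\<^sub>1\<close> is moved to the second variable by hypothesis, taken
  past the sum in the first variable, and recombined with \<open>A\<^sub>n\<^sub>+\<^sub>1\<close>, which the induction
  hypothesis has moved to the second variable.
\<close>

lemma sphere_sum_transfer:
  fixes V :: "'a \<Rightarrow> 'a \<Rightarrow> 'b::comm_ring_1"
  assumes V: "\<And>x y. x \<in> pverts T \<Longrightarrow> y \<in> pverts T \<Longrightarrow>
      sphere_sum 1 (\<lambda>x'. V x' y) x = sphere_sum 1 (V x) y"
    and "x \<in> pverts T" "y \<in> pverts T"
  shows "sphere_sum n (\<lambda>x'. V x' y) x = sphere_sum n (V x) y"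
  using assms(2,3)
proof (induction n arbitrary: x y rule: induct_nat_012)
  case 0
  then show ?case by (simp add: sphere_sum_0)
next
  case 1
  then show ?case using V by simp
next
  case (ge2 n)
  let ?c = "of_nat (if n = 0 then q + 1 else q) :: 'b"
  have "sphere_sum (Suc n) (sphere_sum 1 (\<lambda>x'. V x' y)) x
      = sphere_sum (Suc n) (\<lambda>x'. sphere_sum 1 (V x') y) x"
    using V ge2.prems by (intro sphere_sum_cong) auto
  also have "\<dots> = sphere_sum 1 (\<lambda>y'. sphere_sum (Suc n) (\<lambda>x'. V x' y') x) y"
    by (rule sphere_sum_swap)
  also have "\<dots> = sphere_sum 1 (sphere_sum (Suc n) (V x)) y"
    using ge2.IH(2) ge2.prems by (intro sphere_sum_cong) auto
  also have "\<dots> = sphere_sum (Suc n) (sphere_sum 1 (V x)) y"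
    by (rule sphere_sum_commute_1[OF ge2.prems(2), symmetric])
  finally show ?case
    using ge2.IH(1)[OF ge2.prems] ge2.prems
    by (simp only: sphere_sum_rec)
qed

lemma sphere_sum_exchange:
  fixes V :: "'a \<Rightarrow> 'a \<Rightarrow> 'b::comm_ring_1"
  assumes V: "\<And>x y. x \<in> pverts T \<Longrightarrow> y \<in> pverts T \<Longrightarrow>
      sphere_sum 1 (\<lambda>x'. V x' y) x = sphere_sum 1 (V x) y"
    and "x \<in> pverts T" "y \<in> pverts T"
  shows "sphere_sum m (\<lambda>x'. sphere_sum n (V x') y) x
    = sphere_sum n (\<lambda>x'. sphere_sum m (V x') y) x"
proof -
  have *: "sphere_sum i (\<lambda>x'. sphere_sum j (V x') y) x
      = sphere_sum i (sphere_sum j (\<lambda>x'. V x' y)) x" for i j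
    using sphere_sum_transfer[OF V] assms(3) by (intro sphere_sum_cong) auto
  show ?thesis
    unfolding * by (rule sphere_sum_commute[OF assms(2)])
qed

end

theorem theorem4p2:
  fixes q :: nat and T :: "'a pair_pre_digraph" and U :: "'a \<Rightarrow> 'a \<Rightarrow> complex"
  assumes "q + 1 > 2"
    and "homogeneous_tree q T"
    and "\<And>x y. x \<in> pverts T \<Longrightarrow> y \<in> pverts T \<Longrightarrow>
           laplacian q T (\<lambda>x'. U x' y) x = laplacian q T (\<lambda>y'. U x y') y"
  shows "(\<forall>x\<in>pverts T. \<forall>y\<in>pverts T. \<forall>m n :: nat.
            (\<Sum>x'\<in>sphere T x m. \<Sum>y'\<in>sphere T y n. U x' y')
            = (\<Sum>x'\<in>sphere T x n. \<Sum>y'\<in>sphere T y m. U x' y'))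
       \<and> (\<forall>x\<in>pverts T. \<forall>y\<in>pverts T. \<forall>n :: nat.
            (\<Sum>x'\<in>sphere T x n. U x' y) = (\<Sum>y'\<in>sphere T y n. U x y'))"
proof -
  interpret homogeneous_tree q T by fact
  \<comment> \<open>The identity terms of the two Laplacians agree, and the factor \<open>1 / (q + 1)\<close> cancels.\<close>
  have "of_nat (q + 1) \<noteq> (0 :: complex)"
    by (simp only: of_nat_eq_0_iff)
  then have U: "sphere_sum 1 (\<lambda>x'. U x' y) x = sphere_sum 1 (U x) y"
    if "x \<in> pverts T" "y \<in> pverts T" for x y
    using assms(3)[OF that] unfolding laplacian_eq_iff by simp
  show ?thesis
    using sphere_sum_exchange[of U, OF U] sphere_sum_transfer[of U, OF U]
    unfolding sphere_sum_def by blast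
qed

end
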